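(* Let $I\in\mathbb{S}$ be fixed. Let $f\in L^2(\mathbb{R},\mathbb{H})$ be a unit vector (i.e. $\|f\|=1$), $U$ an open set of $\mathbb{R}^2$ and $\varepsilon\ge0$ such that $$\int_U|\mathcal{V}_\varphi f(x,\omega)|^2\,dx\,d\omega\ge1-\varepsilon.$$ Then $$|U|\ge\frac{1-\varepsilon}{2},$$ where $|U|$ denotes the Lebesgue measure of $U$.
   Context: $\mathbb{H}$ is the algebra of real quaternions, $\mathbb{S}=\{q\in\mathbb{H}:q^2=-1\}$. $L^2(\mathbb{R},\mathbb{H})$ is the space of square integrable $\mathbb{H}$-valued functions with norm $\|f\|^2=\int_{\mathbb{R}}|f(t)|^2dt$. The quaternionic Segal-Bargmann transform with parameter $\nu=2\pi$ is $\mathcal{B}^S_{\mathbb{H}}(f)(q)=\int_{\mathbb{R}}2^{3/4}e^{-\pi(q^2+t^2)+2\pi\sqrt2\,qt}f(t)\,dt$, $q\in\mathbb{H}$. Let $\varphi(t)=2^{1/4}e^{-\pi t^2}$. For $I\in\mathbb{S}$ fixed, the 1D quaternion short-time Fourier transform (QSTFT) of $f\in L^2(\mathbb{R},\mathbb{H})$ with window $\varphi$ is $$\mathcal{V}_\varphi f(x,\omega)=e^{-I\pi x\omega}\,\mathcal{B}^S_{\mathbb{H}}(f)\!\left(\frac{\bar q}{\sqrt2}\right)e^{-\frac{\pi|q|^2}{2}},\qquad q=x+I\omega,\ (x,\omega)\in\mathbb{R}^2.$$ *)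

theory Defs
  imports "HOL-Analysis.Analysis"
begin

section \<open>The algebra of real quaternions\<close>

datatype quat = Quat (qRe: real) (qI: real) (qJ: real) (qK: real)

lemma quat_eq_iff: "p = q \<longleftrightarrow> qRe p = qRe q \<and> qI p = qI q \<and> qJ p = qJ q \<and> qK p = qK q"
  by (auto intro: quat.expand)

instantiation quat :: real_vector
begin

definition zero_quat :: quat
  where "0 = Quat 0 0 0 0"

definition plus_quat :: "quat \<Rightarrow> quat \<Rightarrow> quat"
  where "p + q = Quat (qRe p + qRe q) (qI p + qI q) (qJ p + qJ q) (qK p + qK q)"

definition uminus_quat :: "quat \<Rightarrow> quat"
  where "- q = Quat (- qRe q) (- qI q) (- qJ q) (- qK q)"

definition minus_quat :: "quat \<Rightarrow> quat \<Rightarrow> quat"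
  where "p - q = Quat (qRe p - qRe q) (qI p - qI q) (qJ p - qJ q) (qK p - qK q)"

definition scaleR_quat :: "real \<Rightarrow> quat \<Rightarrow> quat"
  where "r *\<^sub>R q = Quat (r * qRe q) (r * qI q) (r * qJ q) (r * qK q)"

instance
  by standard
    (simp_all add: quat_eq_iff zero_quat_def plus_quat_def uminus_quat_def minus_quat_def
       scaleR_quat_def algebra_simps)

end

instantiation quat :: real_algebra_1
begin

definition one_quat :: quat
  where "1 = Quat 1 0 0 0"

definition times_quat :: "quat \<Rightarrow> quat \<Rightarrow> quat"
  where "p * q = Quat
    (qRe p * qRe q - qI p * qI q - qJ p * qJ q - qK p * qK q)
    (qRe p * qI q + qI p * qRe q + qJ p * qK q - qK p * qJ q)
    (qRe p * qJ q - qI p * qK q + qJ p * qRe q + qK p * qI q)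
    (qRe p * qK q + qI p * qJ q - qJ p * qI q + qK p * qRe q)"

instance
  by standard
    (simp_all add: quat_eq_iff zero_quat_def one_quat_def plus_quat_def times_quat_def
       scaleR_quat_def algebra_simps)

end

definition qcnj :: "quat \<Rightarrow> quat"
  where "qcnj q = Quat (qRe q) (- qI q) (- qJ q) (- qK q)"

instantiation quat :: real_inner
begin

definition inner_quat :: "quat \<Rightarrow> quat \<Rightarrow> real"
  where "inner_quat p q = qRe p * qRe q + qI p * qI q + qJ p * qJ q + qK p * qK q"

definition norm_quat :: "quat \<Rightarrow> real"
  where "norm_quat q = sqrt ((qRe q)\<^sup>2 + (qI q)\<^sup>2 + (qJ q)\<^sup>2 + (qK q)\<^sup>2)"

definition sgn_quat :: "quat \<Rightarrow> quat"
  where "sgn_quat q = q /\<^sub>R norm q"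

definition dist_quat :: "quat \<Rightarrow> quat \<Rightarrow> real"
  where "dist_quat p q = norm (p - q)"

definition uniformity_quat :: "(quat \<times> quat) filter"
  where "uniformity_quat = (INF e\<in>{0<..}. principal {(p, q). dist p q < e})"

definition open_quat :: "quat set \<Rightarrow> bool"
  where "open_quat U \<longleftrightarrow> (\<forall>p\<in>U. eventually (\<lambda>(p', q). p' = p \<longrightarrow> q \<in> U) uniformity)"

instance
proof
  fix p q r :: quat and a :: real and U :: "quat set"
  show "dist p q = norm (p - q)" by (rule dist_quat_def)
  show "sgn q = q /\<^sub>R norm q" by (rule sgn_quat_def)
  show "(uniformity :: (quat \<times> quat) filter) = (INF e\<in>{0<..}. principal {(p, q). dist p q < e})"
    by (rule uniformity_quat_def)
  show "open U \<longleftrightarrow> (\<forall>p\<in>U. eventually (\<lambda>(p', q). p' = p \<longrightarrow> q \<in> U) uniformity)"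
    by (rule open_quat_def)
  show "inner p q = inner q p"
    by (simp add: inner_quat_def mult.commute)
  show "inner (p + q) r = inner p r + inner q r"
    by (simp add: inner_quat_def plus_quat_def algebra_simps)
  show "inner (a *\<^sub>R p) q = a * inner p q"
    by (simp add: inner_quat_def scaleR_quat_def algebra_simps)
  show "0 \<le> inner p p"
    by (simp add: inner_quat_def)
  show "inner p p = 0 \<longleftrightarrow> p = 0"
    by (simp add: inner_quat_def zero_quat_def quat_eq_iff add_nonneg_eq_0_iff)
  show "norm p = sqrt (inner p p)"
    by (simp add: inner_quat_def norm_quat_def power2_eq_square)
qed

end

instantiation quat :: real_normed_div_algebra
begin

definition inverse_quat :: "quat \<Rightarrow> quat"
  where "inverse q = qcnj q /\<^sub>R (norm q)\<^sup>2"

definition divide_quat :: "quat \<Rightarrow> quat \<Rightarrow> quat"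
  where "p div q = p * inverse (q :: quat)"

instance
proof
  fix p q :: quat
  have n2: "(norm q)\<^sup>2 = (qRe q)\<^sup>2 + (qI q)\<^sup>2 + (qJ q)\<^sup>2 + (qK q)\<^sup>2" for q :: quat
    by (simp add: norm_quat_def)
  have cnj: "qcnj q * q = (norm q)\<^sup>2 *\<^sub>R 1" "q * qcnj q = (norm q)\<^sup>2 *\<^sub>R 1" for q :: quat
    unfolding n2
    by (simp_all add: quat_eq_iff qcnj_def times_quat_def one_quat_def scaleR_quat_def
        power2_eq_square algebra_simps)
  show "inverse q * q = 1" if "q \<noteq> 0"
    using that by (simp add: inverse_quat_def cnj)
  show "q * inverse q = 1" if "q \<noteq> 0"
    using that by (simp add: inverse_quat_def cnj)
  show "p div q = p * inverse q"
    by (rule divide_quat_def)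
  show "inverse (0 :: quat) = 0"
    by (simp add: inverse_quat_def)
  have "(norm (p * q))\<^sup>2 = (norm p * norm q)\<^sup>2"
    unfolding power_mult_distrib n2
    by (simp add: times_quat_def power2_eq_square algebra_simps)
  then show "norm (p * q) = norm p * norm q"
    by (rule power2_eq_imp_eq) simp_all
qed

end

instantiation quat :: euclidean_space
begin

definition Basis_quat :: "quat set"
  where "Basis = {Quat 1 0 0 0, Quat 0 1 0 0, Quat 0 0 1 0, Quat 0 0 0 1}"

instance
proof
  fix u v q :: quat
  show "(Basis :: quat set) \<noteq> {}" and "finite (Basis :: quat set)"
    by (simp_all add: Basis_quat_def)
  show "inner u v = (if u = v then 1 else 0)" if "u \<in> Basis" "v \<in> Basis"
    using that unfolding Basis_quat_def by (elim insertE emptyE) (simp_all add: inner_quat_def)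
  show "(\<forall>u\<in>Basis. inner q u = 0) \<longleftrightarrow> q = 0"
    by (simp add: Basis_quat_def inner_quat_def zero_quat_def quat_eq_iff [of q])
qed

end

definition quat_unit_sphere :: "quat set" (\<open>\<S>\<close>)
  where "\<S> = {q. q\<^sup>2 = - 1}"


section \<open>Square integrable quaternion-valued functions\<close>

text \<open>The members are functions rather than almost-everywhere classes.\<close>

definition L2_quat :: "(real \<Rightarrow> quat) set"
  where "L2_quat = {f \<in> borel_measurable lebesgue. integrable lebesgue (\<lambda>t. (norm (f t))\<^sup>2)}"

definition L2_norm_quat :: "(real \<Rightarrow> quat) \<Rightarrow> real"
  where "L2_norm_quat f = sqrt (LINT t|lebesgue. (norm (f t))\<^sup>2)"


section \<open>Segal-Bargmann transform and short-time Fourier transform\<close>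

text \<open>
  The Segal-Bargmann parameter is \<open>\<nu> = 2 * pi\<close>. The kernel multiplies \<open>f t\<close> from the left,
  and the exponential is the power series in the quaternion algebra.
\<close>

definition segal_bargmann :: "(real \<Rightarrow> quat) \<Rightarrow> quat \<Rightarrow> quat"
  where "segal_bargmann f q =
    (LINT t|lebesgue.
       of_real (2 powr (3 / 4))
       * exp (- of_real pi * (q\<^sup>2 + of_real (t\<^sup>2)) + of_real (2 * pi * sqrt 2) * q * of_real t)
       * f t)"

text \<open>
  The transform with the Gaussian window \<open>\<phi> t = 2 powr (1/4) * exp (- pi * t\<^sup>2)\<close>. It is
  \<^emph>\<open>defined\<close> through the Segal-Bargmann transform, so the window does not occur explicitly.
\<close>

definition qstft_gauss :: "quat \<Rightarrow> (real \<Rightarrow> quat) \<Rightarrow> real \<Rightarrow> real \<Rightarrow> quat"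
  where "qstft_gauss I f x \<omega> =
    (let q = of_real x + I * of_real \<omega> in
       exp (- I * of_real (pi * x * \<omega>))
       * segal_bargmann f (qcnj q / of_real (sqrt 2))
       * of_real (exp (- (pi * (norm q)\<^sup>2 / 2))))"

end

theory Submission
  imports Defs "HOL-Probability.Distributions"
begin

text \<open>
  On a slice, the square of the Segal-Bargmann kernel is a Gaussian in \<open>t\<close> of total mass
  \<open>2 * exp (pi * (norm q)\<^sup>2)\<close>, so by Cauchy-Schwarz the squared modulus of the transform of a unit
  vector is at most \<open>2\<close> everywhere, and its integral over \<open>U\<close> is at most \<open>2\<close> times the measure
  of \<open>U\<close>.
\<close>

lemma qRe_simps [simp]:
  "qRe (p + q) = qRe p + qRe q" "qRe (p - q) = qRe p - qRe q" "qRe (- q) = - qRe q"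
  "qRe (of_real r) = r" "qRe (r *\<^sub>R q) = r * qRe q"
  by (simp_all add: plus_quat_def minus_quat_def uminus_quat_def of_real_def one_quat_def
      scaleR_quat_def)

lemma qcnj_add: "qcnj (p + q) = qcnj p + qcnj q"
  by (simp add: qcnj_def plus_quat_def)

lemma qcnj_scaleR: "qcnj (r *\<^sub>R q) = r *\<^sub>R qcnj q"
  by (simp add: qcnj_def scaleR_quat_def)

lemma qcnj_mult: "qcnj (p * q) = qcnj q * qcnj p"
  by (simp add: qcnj_def times_quat_def)

lemma qcnj_power: "qcnj (q ^ n) = qcnj q ^ n"
proof (induction n)
  case 0
  then show ?case by (simp add: qcnj_def one_quat_def)
next
  case (Suc n)
  then show ?case by (simp add: qcnj_mult power_commutes)
qed

lemma qcnj_mult_self: "qcnj q * q = of_real ((norm q)\<^sup>2)"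
  by (simp add: quat_eq_iff qcnj_def times_quat_def of_real_def one_quat_def scaleR_quat_def
      norm_quat_def power2_eq_square algebra_simps)

lemma bounded_linear_qcnj: "bounded_linear qcnj"
proof (rule bounded_linear_intro [where K = 1])
  show "norm (qcnj q) \<le> norm q * 1" for q
    by (simp add: norm_quat_def qcnj_def)
qed (simp_all add: qcnj_add qcnj_scaleR)

text \<open>Conjugation reverses products but preserves powers of a single element, so as a bounded
  linear map it passes through the exponential series termwise.\<close>

lemma qcnj_exp: "qcnj (exp q) = exp (qcnj q)"
proof -
  have "(\<lambda>n. qcnj (q ^ n /\<^sub>R fact n)) sums qcnj (exp q)"
    by (intro bounded_linear.sums [OF bounded_linear_qcnj] exp_converges)
  then have "(\<lambda>n. qcnj q ^ n /\<^sub>R fact n) sums qcnj (exp q)"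
    by (simp add: qcnj_scaleR qcnj_power)
  with exp_converges [of "qcnj q"] show ?thesis
    using sums_unique2 by blast
qed

text \<open>\<open>q\<close> commutes with \<open>qcnj q\<close>, so the product of
  \<open>exp (qcnj q)\<close> and \<open>exp q\<close> is the exponential of the real number
  \<open>2 * qRe q\<close>.\<close>

lemma norm_exp_quat: "norm (exp q) = exp (qRe q)" for q :: quat
proof -
  have "qcnj q * q = q * qcnj q"
    by (simp add: qcnj_def times_quat_def)
  moreover have "qcnj q + q = of_real (2 * qRe q)"
    by (simp add: quat_eq_iff qcnj_def plus_quat_def of_real_def one_quat_def scaleR_quat_def)
  ultimately have "qcnj (exp q) * exp q = of_real (exp (2 * qRe q))"
    by (simp only: qcnj_exp exp_add_commuting [symmetric] exp_of_real)
  then have "(norm (exp q))\<^sup>2 = exp (2 * qRe q)"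
    by (simp only: qcnj_mult_self of_real_eq_iff)
  also have "\<dots> = (exp (qRe q))\<^sup>2"
    by (simp add: exp_double)
  finally show ?thesis
    by (simp add: power2_eq_iff_nonneg)
qed

lemma unit_sphere_coords:
  assumes "I \<in> \<S>"
  shows "qRe I = 0" and "(qI I)\<^sup>2 + (qJ I)\<^sup>2 + (qK I)\<^sup>2 = 1"
proof -
  have *: "I * I = - 1"
    using assms by (simp add: quat_unit_sphere_def power2_eq_square)
  then have eqs: "qRe I * qRe I - qI I * qI I - qJ I * qJ I - qK I * qK I = - 1"
    "qRe I * qI I = 0" "qRe I * qJ I = 0" "qRe I * qK I = 0"
    by (auto simp add: quat_eq_iff times_quat_def one_quat_def uminus_quat_def)
  show "qRe I = 0"
  \<comment> \<open>A nonzero real part would kill the three imaginary coordinates, leaving a real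
    square equal to -1.\<close>
  proof (rule ccontr)
    assume "qRe I \<noteq> 0"
    with eqs have "qRe I * qRe I = - 1" by simp
    then show False
      using zero_le_square [of "qRe I"] by linarith
  qed
  with eqs(1) show "(qI I)\<^sup>2 + (qJ I)\<^sup>2 + (qK I)\<^sup>2 = 1"
    by (simp add: power2_eq_square)
qed

lemma gaussian_lebesgue:
  shows "integrable lebesgue (\<lambda>t. exp (- (2 * pi * (t - x)\<^sup>2)))"
    and "(LINT t|lebesgue. exp (- (2 * pi * (t - x)\<^sup>2))) = 1 / sqrt 2"
proof -
  \<comment> \<open>With this standard deviation the normal density has exponent
    \<open>- 2 * pi * (t - x)\<^sup>2\<close> and leading factor \<open>sqrt 2\<close>.\<close>
  define \<sigma> where "\<sigma> = 1 / (2 * sqrt pi)"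
  have "\<sigma> > 0" by (simp add: \<sigma>_def)
  have "2 * \<sigma>\<^sup>2 = 1 / (2 * pi)" "2 * pi * \<sigma>\<^sup>2 = 1 / 2"
    by (simp_all add: \<sigma>_def power_divide power_mult_distrib)
  then have eq: "exp (- (2 * pi * (t - x)\<^sup>2)) = normal_density x \<sigma> t / sqrt 2" for t
    by (simp only: normal_density_def) (simp add: real_sqrt_divide mult.commute)
  show "integrable lebesgue (\<lambda>t. exp (- (2 * pi * (t - x)\<^sup>2)))"
    unfolding eq using \<open>\<sigma> > 0\<close> by (simp add: integrable_completion)
  show "(LINT t|lebesgue. exp (- (2 * pi * (t - x)\<^sup>2))) = 1 / sqrt 2"
    unfolding eq using \<open>\<sigma> > 0\<close> by (simp add: integral_completion)
qed

text \<open>Cauchy-Schwarz for a unit vector \<open>f\<close>, by a weighted arithmetic-geometric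
  mean inequality. The weight \<open>s\<close> is the L2 norm of \<open>k\<close>, which makes each
  of the two terms integrate to \<open>s\<close>.\<close>

lemma norm_integral_mult_le:
  fixes k f :: "'a \<Rightarrow> 'b :: {real_normed_algebra, banach, second_countable_topology}"
  assumes k: "integrable M (\<lambda>t. (norm (k t))\<^sup>2)" and f: "integrable M (\<lambda>t. (norm (f t))\<^sup>2)"
    and f1: "(LINT t|M. (norm (f t))\<^sup>2) = 1"
    and ks: "(LINT t|M. (norm (k t))\<^sup>2) = s\<^sup>2" and "s > 0"
  shows "norm (LINT t|M. k t * f t) \<le> s"
proof -
  have "norm (LINT t|M. k t * f t) \<le> (LINT t|M. norm (k t * f t))"
    by (rule integral_norm_bound)
  also have "\<dots> \<le> (LINT t|M. ((norm (k t))\<^sup>2 / s + s * (norm (f t))\<^sup>2) / 2)"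
  \<comment> \<open>Only the dominating function has to be shown integrable: a Bochner integral that
    does not exist is 0, which the nonnegative bound covers.\<close>
  proof (rule integral_mono')
    fix t
    have "0 \<le> (norm (k t) - s * norm (f t))\<^sup>2 / s"
      using \<open>s > 0\<close> by simp
    also have "\<dots> = (norm (k t))\<^sup>2 / s + s * (norm (f t))\<^sup>2 - 2 * (norm (k t) * norm (f t))"
      using \<open>s > 0\<close> by (simp add: power2_eq_square field_simps)
    finally show "norm (k t * f t) \<le> ((norm (k t))\<^sup>2 / s + s * (norm (f t))\<^sup>2) / 2"
      using norm_mult_ineq [of "k t" "f t"] by simp
    show "0 \<le> ((norm (k t))\<^sup>2 / s + s * (norm (f t))\<^sup>2) / 2"
      using \<open>s > 0\<close> by simp
  qed (use k f in simp)
  also have "\<dots> = s"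
    using k f f1 ks \<open>s > 0\<close> by (simp add: power2_eq_square)
  finally show ?thesis .
qed

text \<open>The modulus of the exponential depends only on the real part of its exponent; twice that
  real part equals \<open>pi * (norm q)\<^sup>2 - 2 * pi * (t - x)\<^sup>2\<close> after completing
  the square in \<open>t\<close>.\<close>

lemma norm_segal_bargmann_kernel:
  assumes "I \<in> \<S>" and q: "q = of_real x + I * of_real \<omega>"
  shows "(norm (of_real (2 powr (3 / 4)) *
      exp (- of_real pi * ((qcnj q / of_real (sqrt 2))\<^sup>2 + of_real (t\<^sup>2))
        + of_real (2 * pi * sqrt 2) * (qcnj q / of_real (sqrt 2)) * of_real t) :: quat))\<^sup>2
    = 2 * sqrt 2 * exp (pi * (norm q)\<^sup>2) * exp (- (2 * pi * (t - x)\<^sup>2))"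
proof -
  note I = unit_sphere_coords [OF assms(1)]
  define p where "p = qcnj q / of_real (sqrt 2)"
  have coords: "qRe q = x" "qI q = qI I * \<omega>" "qJ q = qJ I * \<omega>" "qK q = qK I * \<omega>"
    by (simp_all add: q plus_quat_def times_quat_def of_real_def one_quat_def scaleR_quat_def I)
  have p: "p = (1 / sqrt 2) *\<^sub>R qcnj q"
    unfolding p_def divide_inverse of_real_inverse [symmetric] by (simp add: of_real_def)
  have sum: "(qI I * \<omega>)\<^sup>2 + (qJ I * \<omega>)\<^sup>2 + (qK I * \<omega>)\<^sup>2 = \<omega>\<^sup>2"
    using I(2) by (simp add: power_mult_distrib flip: distrib_right)
  have nq: "(norm q)\<^sup>2 = x\<^sup>2 + \<omega>\<^sup>2"
    using sum by (simp add: norm_quat_def coords)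
  have "qRe (p\<^sup>2) = (x\<^sup>2 - \<omega>\<^sup>2) / 2"
    unfolding sum [symmetric]
    by (simp add: p power2_eq_square times_quat_def qcnj_def coords scaleR_quat_def field_simps)
  moreover have "qRe p = x / sqrt 2"
    by (simp add: p qcnj_def coords)
  \<comment> \<open>\<open>qRe\<close> is real-linear but not multiplicative, so products with real
    quaternions are turned into scalings.\<close>
  moreover have "- of_real pi * (p\<^sup>2 + of_real (t\<^sup>2)) + of_real (2 * pi * sqrt 2) * p * of_real t
      = - (pi *\<^sub>R (p\<^sup>2 + of_real (t\<^sup>2))) + (2 * pi * sqrt 2 * t) *\<^sub>R p"
    by (simp add: of_real_def mult.commute mult.left_commute)
  ultimately have "qRe (- of_real pi * (p\<^sup>2 + of_real (t\<^sup>2)) + of_real (2 * pi * sqrt 2) * p * of_real t)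
      = - pi * ((x\<^sup>2 - \<omega>\<^sup>2) / 2 + t\<^sup>2) + 2 * pi * t * x"
    by (simp flip: of_real_power)
  moreover have "(2 powr (3 / 4))\<^sup>2 = 2 * sqrt (2 :: real)"
  proof -
    have "(2 powr (3 / 4))\<^sup>2 = (2 :: real) powr (1 + 1 / 2)"
      by (simp add: power2_eq_square powr_add [symmetric])
    also have "\<dots> = 2 * sqrt 2"
      by (subst powr_add) (simp add: powr_half_sqrt)
    finally show ?thesis .
  qed
  ultimately show ?thesis
    unfolding p_def [symmetric] nq
    by (simp add: norm_mult norm_exp_quat power_mult_distrib exp_double [symmetric] mult_exp_exp)
      (simp add: power2_eq_square field_simps)
qed

lemma norm_qstft_gauss_le:
  assumes I: "I \<in> \<S>" and f: "f \<in> L2_quat" "L2_norm_quat f = 1"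
  shows "(norm (qstft_gauss I f x \<omega>))\<^sup>2 \<le> 2"
proof -
  define q where "q = of_real x + I * of_real \<omega>"
  \<comment> \<open>This is the L2 norm of the kernel: the Gaussian integral
    \<open>1 / sqrt 2\<close> reduces the factor \<open>2 * sqrt 2\<close> to 2.\<close>
  define s where "s = sqrt 2 * exp (pi * (norm q)\<^sup>2 / 2)"
  have s2: "s\<^sup>2 = 2 * exp (pi * (norm q)\<^sup>2)"
    by (simp add: s_def power_mult_distrib exp_double [symmetric])
  note kernel = norm_segal_bargmann_kernel [OF I q_def]
  have "norm (segal_bargmann f (qcnj q / of_real (sqrt 2))) \<le> s"
    unfolding segal_bargmann_def
  proof (rule norm_integral_mult_le, unfold kernel)
    show "s > 0" by (simp add: s_def)
    show "(LINT t|lebesgue. 2 * sqrt 2 * exp (pi * (norm q)\<^sup>2) * exp (- (2 * pi * (t - x)\<^sup>2))) = s\<^sup>2"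
      by (simp add: gaussian_lebesgue s2)
  qed (use f gaussian_lebesgue in \<open>simp_all add: L2_quat_def L2_norm_quat_def\<close>)
  \<comment> \<open>The phase has modulus 1 because its exponent is a real multiple of
    \<open>I\<close>, whose real part vanishes.\<close>
  moreover have "norm (exp (- I * of_real (pi * x * \<omega>))) = 1"
  proof -
    have "- I * of_real (pi * x * \<omega>) = (- (pi * x * \<omega>)) *\<^sub>R I"
      by (simp add: of_real_def)
    then show ?thesis
      by (simp only: norm_exp_quat qRe_simps unit_sphere_coords(1) [OF I]) simp
  qed
  ultimately have "norm (qstft_gauss I f x \<omega>) \<le> s * exp (- (pi * (norm q)\<^sup>2 / 2))"
    unfolding qstft_gauss_def Let_def q_def [symmetric] by (simp add: norm_mult)
  \<comment> \<open>The Gaussian weight cancels exactly the growth of \<open>s\<close> in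
    \<open>q\<close>, so the bound is uniform.\<close>
  also have "\<dots> = sqrt 2"
    by (simp add: s_def exp_minus)
  finally show ?thesis
    using power_mono [of _ "sqrt 2" 2] by fastforce
qed

theorem theorem5p13:
  fixes I :: quat and f :: "real \<Rightarrow> quat" and U :: "(real \<times> real) set" and \<epsilon> :: real
  assumes "I \<in> \<S>"
    and "f \<in> L2_quat" and "L2_norm_quat f = 1"
    and "open U"
    and "\<epsilon> \<ge> 0"
    and "(\<integral>\<^sup>+ (x, \<omega>) \<in> U. ennreal ((norm (qstft_gauss I f x \<omega>))\<^sup>2) \<partial>lebesgue) \<ge> ennreal (1 - \<epsilon>)"
  shows "emeasure lebesgue U \<ge> ennreal ((1 - \<epsilon>) / 2)"
proof -
  have "ennreal (1 - \<epsilon>) \<le> (\<integral>\<^sup>+ z. 2 * indicator U z \<partial>lebesgue)"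
  proof (rule order_trans [OF assms(6)], rule nn_integral_mono)
    fix z :: "real \<times> real"
    have "ennreal ((norm (qstft_gauss I f (fst z) (snd z)))\<^sup>2) \<le> ennreal 2"
      by (intro ennreal_leI norm_qstft_gauss_le assms)
    then show "(case z of (x, \<omega>) \<Rightarrow> ennreal ((norm (qstft_gauss I f x \<omega>))\<^sup>2)) * indicator U z
        \<le> 2 * indicator U z"
      by (simp add: case_prod_beta mult_right_mono)
  qed
  also have "\<dots> = 2 * emeasure lebesgue U"
    using \<open>open U\<close> by (intro nn_integral_cmult_indicator) simp
  \<comment> \<open>Halving is done by multiplication with a finite constant, which stays valid if
    \<open>U\<close> has infinite measure.\<close>
  finally have "ennreal (1 / 2) * ennreal (1 - \<epsilon>) \<le> ennreal (1 / 2) * (2 * emeasure lebesgue U)"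
    by (rule mult_left_mono) simp
  also have "\<dots> = ennreal (1 / 2 * 2) * emeasure lebesgue U"
    by (subst ennreal_mult) (simp_all add: mult.assoc)
  finally show ?thesis
    \<comment> \<open>\<open>ennreal_mult'\<close> asks only that \<open>1 / 2\<close> be
      nonnegative; for \<epsilon> > 1 both sides of the rewriting are 0 by truncation.\<close>
    by (simp only: ennreal_mult' [symmetric]) simp
qed

end
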